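(* If $r$ is a balanced rotor type, then $UD(r)$ is palindromic only if $r$ starts and ends with the same term, i.e. $r^{(1)}=r^{(|r|)}$.
   Context: A rotor type is an infinite periodic sequence $r=(r^{(1)},r^{(2)},\dots)$ of states, with (fundamental) period $|r|$; it is palindromic if $r^{(k)}=r^{(|r|+1-k)}$ for all $k$. A two-state rotor type is written over $\{1,2\}$ with the convention $r^{(1)}=1$; it is balanced if $1$ and $2$ occur equally often in a period. Rotor-router dynamics: at each non-target vertex $v$ there is a periodic sequence $e_v^{(1)},e_v^{(2)},\dots$ of out-edges; a particle starts at the source, on its $n$-th visit to a non-target vertex $v$ leaves along $e_v^{(n)}$, and whenever it reaches a target it is returned to the source; the hitting sequence is the (periodic) sequence of targets reached. The compressor $UD$ for $r$ has non-target vertices $1$ (source), $2,3$ and targets $4,5$; on the $n$-th departure: from vertex $1$ the particle goes to vertex $2$ if $r^{(n)}=1$ and to vertex $3$ if $r^{(n)}=2$; from vertex $2$ it goes to vertex $1$ if $r^{(n)}=1$ and to target $4$ if $r^{(n)}=2$; from vertex $3$ it goes to target $5$ if $r^{(n)}=1$ and to vertex $1$ if $r^{(n)}=2$. $UD(r)$ is its hitting sequence, viewed as a rotor type (with $4$ written as $1$ and $5$ as $2$). *)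

theory Defs
  imports "HOL-Library.Infinite_Set"
begin

text \<open>
  Sequences are functions on \<open>nat\<close>, read only at the indices \<open>1, 2, 3, \<dots>\<close>;
  the value at \<open>0\<close> is irrelevant.
\<close>

definition is_period :: "(nat \<Rightarrow> 'a) \<Rightarrow> nat \<Rightarrow> bool" where
  "is_period r p \<longleftrightarrow> p \<ge> 1 \<and> (\<forall>k\<ge>1. r (k + p) = r k)"

definition rotor_type :: "(nat \<Rightarrow> 'a) \<Rightarrow> bool" where
  "rotor_type r \<longleftrightarrow> (\<exists>p. is_period r p)"

definition period :: "(nat \<Rightarrow> 'a) \<Rightarrow> nat" where
  "period r = (LEAST p. is_period r p)"

definition palindromic :: "(nat \<Rightarrow> 'a) \<Rightarrow> bool" where
  "palindromic r \<longleftrightarrow> (\<forall>k\<in>{1..period r}. r k = r (period r + 1 - k))"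

definition two_state_rotor_type :: "(nat \<Rightarrow> nat) \<Rightarrow> bool" where
  "two_state_rotor_type r \<longleftrightarrow> rotor_type r \<and> (\<forall>k\<ge>1. r k \<in> {1, 2}) \<and> r 1 = 1"

definition balanced :: "(nat \<Rightarrow> nat) \<Rightarrow> bool" where
  "balanced r \<longleftrightarrow> card {k \<in> {1..period r}. r k = 1} = card {k \<in> {1..period r}. r k = 2}"

text \<open>
  Rotor-router dynamics: \<open>e v n\<close> is the head of the edge along which the particle leaves the
  non-target vertex \<open>v\<close> on its \<open>n\<close>-th visit, \<open>T\<close> is the set of targets, \<open>s\<close> is the source.
  A state consists of the particle's position and the number of departures so far from each
  vertex.  The return from a target to the source takes one time step.
\<close>

primrec rotor_state ::
  "('v \<Rightarrow> nat \<Rightarrow> 'v) \<Rightarrow> 'v set \<Rightarrow> 'v \<Rightarrow> nat \<Rightarrow> 'v \<times> ('v \<Rightarrow> nat)" where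
  "rotor_state e T s 0 = (s, \<lambda>_. 0)"
| "rotor_state e T s (Suc t) =
     (let (v, c) = rotor_state e T s t
      in if v \<in> T then (s, c) else (e v (c v + 1), c(v := c v + 1)))"

definition particle_position ::
  "('v \<Rightarrow> nat \<Rightarrow> 'v) \<Rightarrow> 'v set \<Rightarrow> 'v \<Rightarrow> nat \<Rightarrow> 'v" where
  "particle_position e T s t = fst (rotor_state e T s t)"

text \<open>
  \<open>enumerate\<close> counts from \<open>0\<close>, whereas the first target reached is \<open>hitting_sequence e T s 1\<close>.
  The definition is meaningful when targets are reached infinitely often.
\<close>

definition hitting_sequence ::
  "('v \<Rightarrow> nat \<Rightarrow> 'v) \<Rightarrow> 'v set \<Rightarrow> 'v \<Rightarrow> nat \<Rightarrow> 'v" where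
  "hitting_sequence e T s k =
     particle_position e T s (enumerate {t. particle_position e T s t \<in> T} (k - 1))"

text \<open>
  The compressor has non-target vertices \<open>1\<close> (the source), \<open>2\<close>, \<open>3\<close> and targets \<open>4\<close>, \<open>5\<close>.
  The last clause of \<open>UD_edge\<close> is a dummy: it only concerns vertices other than \<open>1, 2, 3\<close>.
\<close>

definition UD_edge :: "(nat \<Rightarrow> nat) \<Rightarrow> nat \<Rightarrow> nat \<Rightarrow> nat" where
  "UD_edge r v n =
     (if v = 1 then (if r n = 1 then 2 else 3)
      else if v = 2 then (if r n = 1 then 1 else 4)
      else if v = 3 then (if r n = 1 then 5 else 1)
      else v)"

text \<open>
  Targets \<open>4\<close> and \<open>5\<close> are written as \<open>1\<close> and \<open>2\<close>, without renaming the states so that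
  the first term becomes \<open>1\<close>; being palindromic does not depend on the names of the states.
\<close>

definition UD :: "(nat \<Rightarrow> nat) \<Rightarrow> nat \<Rightarrow> nat" where
  "UD r k = (if hitting_sequence (UD_edge r) {4, 5} 1 k = 4 then 1 else 2)"

end

theory Submission imports Defs begin

text \<open>
  The \<open>n\<close>-th departure from the source, with \<open>r n = x\<close>, leads to a target iff the \<open>i\<close>-th term of
  \<open>r\<close> differs from \<open>x\<close>, where \<open>i\<close> counts the occurrences of \<open>x\<close> up to \<open>n\<close>; the target reached
  then encodes \<open>x\<close>.  So \<open>UD r\<close> is the subsequence of \<open>r\<close> read off at these departures, and for
  balanced \<open>r\<close> of period \<open>N\<close> the set of these departures is invariant under a shift by \<open>2 * N\<close>.
  If \<open>r\<close> starts with \<open>1\<close>, the first such departure is the first \<open>2\<close> of \<open>r\<close>.  If \<open>r\<close> moreover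
  ends with \<open>2\<close>, the last one up to \<open>2 * N\<close> is the last \<open>1\<close> in that range.  Hence a period of
  \<open>UD r\<close> starts with \<open>2\<close> and ends with \<open>1\<close>.
\<close>

section \<open>Ranks in infinite sets of naturals\<close>

text \<open>Inverts \<open>enumerate\<close> by rank, so that positions in an enumeration can be
  found by counting.\<close>

lemma enumerate_card_less:
  fixes B :: "nat set"
  assumes "infinite B" "x \<in> B"
  shows "enumerate B (card {y \<in> B. y < x}) = x"
proof -
  obtain j where j: "x = enumerate B j"
    using assms by (metis enumerate_Ex)
  have "{y \<in> B. y < x} = enumerate B ` {..<j}"
    using assms(1) j by (auto simp: enumerate_in_set) (metis assms(1) enumerate_Ex enumerate_mono_iff imageI lessThan_iff)
  then have "card {y \<in> B. y < x} = j"
    using card_image[OF inj_on_subset[OF inj_enumerate[OF assms(1)] subset_UNIV]] by simp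
  then show ?thesis using j by simp
qed

text \<open>A strictly monotone map preserves ranks: the elements of the image below
  \<open>f x\<close> are the images of those below \<open>x\<close>.\<close>

lemma enumerate_image:
  fixes B :: "nat set" and f :: "nat \<Rightarrow> nat"
  assumes inf: "infinite B" and mono: "strict_mono_on B f"
  shows "enumerate (f ` B) k = f (enumerate B k)"
proof -
  let ?x = "enumerate B k"
  have x: "?x \<in> B" using inf by (simp add: enumerate_in_set)
  have inj: "inj_on f B" using mono by (rule strict_mono_on_imp_inj_on)
  have "{y \<in> f ` B. y < f ?x} = f ` {y \<in> B. y < ?x}"
    using x strict_mono_on_less[OF mono] by auto
  then have "card {y \<in> f ` B. y < f ?x} = card {y \<in> B. y < ?x}"
    using inj by (simp add: card_image inj_on_subset)
  also have "\<dots> = k"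
    using enumerate_card_less[OF inf x] inj_enumerate[OF inf] by (auto dest: injD)
  finally show ?thesis
    using enumerate_card_less[of "f ` B" "f ?x"] inf x inj by (auto simp: finite_image_iff)
qed

lemma enumerate_add_period:
  fixes B :: "nat set"
  assumes inf: "infinite B" and per: "\<And>n. n + P \<in> B \<longleftrightarrow> n \<in> B"
  shows "enumerate B (k + card {y \<in> B. y < P}) = enumerate B k + P"
proof -
  let ?x = "enumerate B k"
  have x: "?x \<in> B" using inf by (simp add: enumerate_in_set)
  \<comment> \<open>The elements below \<open>P\<close> add a fixed amount to the rank; the others
    are the translates of those below \<open>?x\<close>.\<close>
  have "{y \<in> B. y < ?x + P} = (\<lambda>y. y + P) ` {y \<in> B. y < ?x} \<union> {y \<in> B. y < P}" (is "?l = ?a \<union> ?b")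
  proof
    show "?l \<subseteq> ?a \<union> ?b"
    proof
      fix y assume y: "y \<in> ?l"
      show "y \<in> ?a \<union> ?b"
      proof (cases "y < P")
        case False
        then have "y = (y - P) + P" by simp
        moreover from this have "y - P \<in> B" using y per by (metis (lifting) mem_Collect_eq)
        ultimately show ?thesis using y by (auto intro!: image_eqI[of _ _ "y - P"])
      qed (use y in auto)
    qed
  qed (auto simp: per)
  then have "card {y \<in> B. y < ?x + P} = card ?a + card ?b"
    by (simp only:) (rule card_Un_disjoint, auto)
  also have "card ?a = card {y \<in> B. y < ?x}" by (simp add: card_image)
  also have "\<dots> = k"
    using enumerate_card_less[OF inf x] inj_enumerate[OF inf] by (auto dest: injD)
  finally show ?thesis
    using enumerate_card_less[OF inf, of "?x + P"] x per by simp
qed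

section \<open>Arbitrary periods and the fundamental period\<close>

lemma is_period_mult:
  assumes "is_period r p" "k \<ge> 1"
  shows "r (k + j * p) = r k"
proof (induction j)
  case (Suc j)
  have "r (k + j * p + p) = r (k + j * p)"
    using assms by (simp add: is_period_def)
  with Suc show ?case by (simp add: algebra_simps)
qed simp

lemma is_period_period:
  "rotor_type r \<Longrightarrow> is_period r (period r)"
  unfolding rotor_type_def period_def by (metis LeastI)

text \<open>The product of the two periods is a multiple of each, and the value there equals both
  sides. The last term of the fundamental period can thus be read off at any period.\<close>

lemma rotor_type_at_period:
  assumes "is_period r p"
  shows "r (period r) = r p"
proof -
  let ?q = "period r"
  have q: "is_period r ?q"
    using assms is_period_period rotor_type_def by blast
  have pos: "p \<ge> 1" "?q \<ge> 1" using assms q by (auto simp: is_period_def)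
  have "r (?q + (p - 1) * ?q) = r ?q" "r (p + (?q - 1) * p) = r p"
    using is_period_mult[OF q pos(2)] is_period_mult[OF assms pos(1)] by auto
  moreover have "?q + (p - 1) * ?q = p + (?q - 1) * p"
    using pos by (simp add: algebra_simps diff_mult_distrib)
  ultimately show ?thesis by simp
qed

section \<open>Counting occurrences of a state in a prefix\<close>

definition occurrences :: "(nat \<Rightarrow> 'a) \<Rightarrow> 'a \<Rightarrow> nat \<Rightarrow> nat" where
  "occurrences r x n = card {k \<in> {1..n}. r k = x}"

lemma occurrences_0 [simp]: "occurrences r x 0 = 0"
  by (simp add: occurrences_def)

lemma occurrences_Suc [simp]:
  "occurrences r x (Suc n) = occurrences r x n + (if r (Suc n) = x then 1 else 0)"
proof -
  have "{k \<in> {1..Suc n}. r k = x}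
      = {k \<in> {1..n}. r k = x} \<union> (if r (Suc n) = x then {Suc n} else {})"
    by (auto simp: le_Suc_eq)
  then show ?thesis by (auto simp: occurrences_def)
qed

lemma occurrences_pos:
  assumes "k \<ge> 1"
  shows "occurrences r (r k) k \<ge> 1"
  using assms by (cases k) auto

lemma occurrences_add_period:
  assumes "is_period r p"
  shows "occurrences r x (n + p) = occurrences r x n + occurrences r x p"
proof (induction n)
  case (Suc n)
  have "r (Suc n + p) = r (Suc n)" using assms by (auto simp: is_period_def)
  with Suc show ?case by simp
qed simp

lemma occurrences_constant_run:
  assumes "a \<le> b" "\<And>k. a < k \<Longrightarrow> k \<le> b \<Longrightarrow> r k = x"
  shows "occurrences r y b = occurrences r y a + (if y = x then b - a else 0)"
  using assms by (induction b rule: dec_induct) (auto simp: Suc_diff_le)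

lemma occurrences_two_states:
  assumes "\<And>k. k \<ge> 1 \<Longrightarrow> r k \<in> {1, 2 :: nat}"
  shows "occurrences r 1 n + occurrences r 2 n = n"
proof (induction n)
  case (Suc n)
  with assms[of "Suc n"] show ?case by auto
qed simp

section \<open>Excursions from the source and the hitting sequence\<close>

definition hitting_departures :: "(nat \<Rightarrow> nat) \<Rightarrow> nat set" where
  "hitting_departures r = {n. n \<ge> 1 \<and> r (occurrences r (r n) n) \<noteq> r n}"

text \<open>The time at which the particle is back at the source after \<open>n\<close> departures from it.\<close>

primrec return_time :: "(nat \<Rightarrow> nat) \<Rightarrow> nat \<Rightarrow> nat" where
  "return_time r 0 = 0"
| "return_time r (Suc n) =
     return_time r n + (if Suc n \<in> hitting_departures r then 3 else 2)"

lemma strict_mono_return_time: "strict_mono (return_time r)"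
  by (simp add: strict_mono_Suc_iff)

text \<open>Vertices 2 and 3 are entered only from the source, so at a return their departure counts
  are the numbers of 1s and 2s among the first \<open>n\<close> terms of \<open>r\<close>.\<close>

definition UD_counts :: "(nat \<Rightarrow> nat) \<Rightarrow> nat \<Rightarrow> nat \<Rightarrow> nat" where
  "UD_counts r n = (\<lambda>_. 0)(1 := n, 2 := occurrences r 1 n, 3 := occurrences r 2 n)"

context
  fixes r :: "nat \<Rightarrow> nat"
  assumes states: "\<And>k. k \<ge> 1 \<Longrightarrow> r k \<in> {1, 2}"
begin

abbreviation "ud_state \<equiv> rotor_state (UD_edge r) {4, 5} 1"

abbreviation "ud_position \<equiv> particle_position (UD_edge r) {4, 5} 1"

lemma rotor_state_excursion:
  assumes "ud_state t = (1, UD_counts r n)"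
  shows "ud_position t = 1"
    and "ud_position (t + 1) \<notin> {4, 5}"
    and "Suc n \<in> hitting_departures r \<Longrightarrow> ud_position (t + 2) = (if r (Suc n) = 1 then 4 else 5)"
    and "ud_state (t + (if Suc n \<in> hitting_departures r then 3 else 2)) = (1, UD_counts r (Suc n))"
proof -
  have rn: "r (Suc n) = 1 \<or> r (Suc n) = 2" using states[of "Suc n"] by simp
  \<comment> \<open>The count includes position \<open>Suc n\<close> itself, so the index read at
    vertex 2 or 3 is never 0, where \<open>r\<close> is unconstrained.\<close>
  have rk: "r (occurrences r (r (Suc n)) (Suc n)) \<in> {1, 2}"
    using states occurrences_pos[of "Suc n" r] by simp
  show "ud_position t = 1"
    using assms by (simp add: particle_position_def)
  show "ud_position (t + 1) \<notin> {4, 5}"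
    using assms by (simp add: particle_position_def UD_edge_def)
  show "Suc n \<in> hitting_departures r \<Longrightarrow> ud_position (t + 2) = (if r (Suc n) = 1 then 4 else 5)"
    using assms rn rk
    by (elim disjE)
      (simp_all add: particle_position_def UD_edge_def UD_counts_def hitting_departures_def)
  show "ud_state (t + (if Suc n \<in> hitting_departures r then 3 else 2)) = (1, UD_counts r (Suc n))"
    using rn
  proof (elim disjE)
    assume "r (Suc n) = 1"
    then show ?thesis
      using assms rk
      by (simp add: numeral_3_eq_3 numeral_2_eq_2 UD_edge_def UD_counts_def hitting_departures_def fun_eq_iff)
  next
    assume "r (Suc n) = 2"
    then show ?thesis
      using assms rk
      by (simp add: numeral_3_eq_3 numeral_2_eq_2 UD_edge_def UD_counts_def hitting_departures_def fun_eq_iff) blast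
  qed
qed

lemma rotor_state_return_time: "ud_state (return_time r n) = (1, UD_counts r n)"
proof (induction n)
  case 0
  show ?case by (auto simp: UD_counts_def fun_eq_iff)
next
  case (Suc n)
  then show ?case using rotor_state_excursion(4) by simp
qed

text \<open>Excursions partition time, and only offset 2 of an excursion of length 3 is at a target.
  The \<open>n\<close>-th departure takes place at time
  \<open>return_time r (n - 1)\<close>.\<close>

lemma hitting_times:
  "{t. ud_position t \<in> {4, 5}} = (\<lambda>n. return_time r (n - 1) + 2) ` hitting_departures r"
proof (intro equalityI subsetI)
  fix t assume "t \<in> {t. ud_position t \<in> {4, 5}}"
  then have t: "ud_position t \<in> {4, 5}" by simp
  have "\<exists>n. return_time r n \<le> t \<and> t < return_time r (Suc n)"
  proof -
    have "t < return_time r (Suc t)"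
      using strict_mono_imp_increasing[OF strict_mono_return_time, of "Suc t" r] by simp
    \<comment> \<open>The least such \<open>m\<close> is positive; its predecessor indexes the
      excursion containing \<open>t\<close>.\<close>
    then obtain m where m: "t < return_time r m" "\<And>k. k < m \<Longrightarrow> \<not> t < return_time r k"
      using exists_least_iff[of "\<lambda>m. t < return_time r m"] by blast
    then have "m \<noteq> 0" by (cases m) auto
    then show ?thesis using m by (metis lessI not_less not0_implies_Suc)
  qed
  then obtain n where n: "return_time r n \<le> t" "t < return_time r (Suc n)" by blast
  let ?s = "return_time r n"
  note ex = rotor_state_excursion[OF rotor_state_return_time[of n]]
  have "t \<noteq> ?s" "t \<noteq> ?s + 1" using ex(1,2) t by auto
  then have "Suc n \<in> hitting_departures r" "t = ?s + 2"
    using n by (auto split: if_splits)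
  then show "t \<in> (\<lambda>n. return_time r (n - 1) + 2) ` hitting_departures r"
    by (auto intro!: image_eqI[of _ _ "Suc n"])
next
  fix t assume "t \<in> (\<lambda>n. return_time r (n - 1) + 2) ` hitting_departures r"
  then obtain n where n: "n \<in> hitting_departures r" "t = return_time r (n - 1) + 2" by blast
  then have "Suc (n - 1) = n" by (simp add: hitting_departures_def)
  then show "t \<in> {t. ud_position t \<in> {4, 5}}"
    using n rotor_state_excursion(3)[OF rotor_state_return_time[of "n - 1"]] by simp
qed

lemma UD_eq:
  assumes inf: "infinite (hitting_departures r)"
  shows "UD r k = r (enumerate (hitting_departures r) (k - 1))"
proof -
  let ?n = "enumerate (hitting_departures r) (k - 1)"
  have n: "?n \<in> hitting_departures r" using inf by (simp add: enumerate_in_set)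
  then have Suc: "Suc (?n - 1) = ?n" by (simp add: hitting_departures_def)
  have mono: "strict_mono_on (hitting_departures r) (\<lambda>n. return_time r (n - 1) + 2)"
    by (auto simp: hitting_departures_def intro!: strict_mono_onI
        strict_monoD[OF strict_mono_return_time])
  have "hitting_sequence (UD_edge r) {4, 5} 1 k = ud_position (return_time r (?n - 1) + 2)"
    unfolding hitting_sequence_def hitting_times enumerate_image[OF inf mono] ..
  also have "\<dots> = (if r ?n = 1 then 4 else 5)"
    using rotor_state_excursion(3)[OF rotor_state_return_time[of "?n - 1"]] n Suc by simp
  finally show ?thesis
    using states[of ?n] n by (auto simp: UD_def hitting_departures_def)
qed

section \<open>Hitting departures of a balanced rotor type\<close>

text \<open>Over two periods each state occurs exactly \<open>N\<close> times, so the counts move by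
  a period of \<open>r\<close>; a single period would move them only by half of
  \<open>N\<close>.\<close>

lemma hitting_departures_add_period:
  assumes per: "is_period r N" and bal: "occurrences r 1 N = occurrences r 2 N"
  shows "n + 2 * N \<in> hitting_departures r \<longleftrightarrow> n \<in> hitting_departures r"
proof -
  have N: "occurrences r 1 N + occurrences r 2 N = N"
    by (rule occurrences_two_states) (rule states)
  show ?thesis
  proof (cases "n = 0")
    case True
    \<comment> \<open>Index 0 is excluded by definition. Index \<open>2 * N\<close> is the
      \<open>N\<close>-th occurrence of the state \<open>r N\<close>, so \<open>r N\<close> is
      compared with itself.\<close>
    have "r (2 * N) = r N" using per by (simp add: is_period_def mult_2)
    moreover have "occurrences r (r N) (2 * N) = N"
      using occurrences_add_period[OF per, of "r N" N] bal N states[of N] per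
      by (auto simp: is_period_def mult_2)
    ultimately show ?thesis using True by (simp add: hitting_departures_def)
  next
    case False
    then have n: "n \<ge> 1" by simp
    have rn: "r (n + 2 * N) = r n" using is_period_mult[OF per n] .
    have "occurrences r (r n) (n + 2 * N) = occurrences r (r n) n + N"
      using occurrences_add_period[OF per, of "r n" "n + N"]
        occurrences_add_period[OF per, of "r n" n] bal N states[OF n]
      by (auto simp: mult_2 add.assoc)
    moreover have "r (occurrences r (r n) n + N) = r (occurrences r (r n) n)"
      using per occurrences_pos[OF n, of r] by (simp add: is_period_def)
    ultimately show ?thesis using rn n by (simp add: hitting_departures_def)
  qed
qed

text \<open>In the initial run of 1s the count at \<open>j\<close> is \<open>j\<close>, so each term
  is compared with itself. The first 2 is compared with \<open>r 1\<close>.\<close>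

lemma first_hitting_departure:
  assumes "r 1 = 1" "k \<ge> 1" "r k = 2"
  shows "\<exists>n \<in> hitting_departures r. r n = 2 \<and> (\<forall>j < n. j \<notin> hitting_departures r)"
proof -
  define n where "n = (LEAST k. k \<ge> 1 \<and> r k = 2)"
  have n: "n \<ge> 1" "r n = 2"
    using LeastI[of "\<lambda>k. k \<ge> 1 \<and> r k = 2" k] assms by (auto simp: n_def)
  have ones: "r j = 1" if "j \<ge> 1" "j < n" for j
    using not_less_Least[of j "\<lambda>k. k \<ge> 1 \<and> r k = 2"] states[of j] that by (auto simp: n_def)
  have "occurrences r 2 (n - 1) = 0"
    using occurrences_constant_run[of 0 "n - 1" r 1 2] ones by simp
  then have "occurrences r 2 n = 1"
    using n by (cases n) auto
  then have "n \<in> hitting_departures r"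
    using n assms(1) by (simp add: hitting_departures_def)
  moreover have "j \<notin> hitting_departures r" if "j < n" for j
    using occurrences_constant_run[of 0 j r 1 1] ones that
    by (auto simp: hitting_departures_def)
  ultimately show ?thesis using n by blast
qed

text \<open>The witness is the last 1 in two periods; being the \<open>N\<close>-th 1, it is
  compared with \<open>r N\<close>, which is 2.\<close>

lemma last_hitting_departure:
  assumes per: "is_period r N" and bal: "occurrences r 1 N = occurrences r 2 N"
    and r1: "r 1 = 1" and rN: "r N = 2"
  shows "\<exists>n \<in> hitting_departures r. n < 2 * N \<and> r n = 1 \<and>
           (\<forall>j \<in> {n<..2 * N}. j \<notin> hitting_departures r)"
proof -
  have N: "occurrences r 1 N + occurrences r 2 N = N"
    by (rule occurrences_two_states) (rule states)
  have N1: "N \<ge> 1" using per by (simp add: is_period_def)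
  have shift: "r (k + N) = r k" if "k \<ge> 1" for k
    using per that by (simp add: is_period_def)
  define l where "l = Max {k \<in> {1..N}. r k = 1}"
  have "l \<in> {k \<in> {1..N}. r k = 1}"
    unfolding l_def using r1 N1 by (intro Max_in) auto
  then have l: "l \<ge> 1" "l < N" "r l = 1"
    using rN by (auto simp: le_less)
  have twos: "r k = 2" if "l < k" "k \<le> N" for k
  proof -
    have "finite {k \<in> {1..N}. r k = 1}" by simp
    then have "k \<notin> {k \<in> {1..N}. r k = 1}"
      using that(1) Max_ge unfolding l_def by (meson not_le)
    then show ?thesis using that states[of k] by auto
  qed
  have "occurrences r 1 (l + N) = N"
    using occurrences_add_period[OF per, of 1 l] occurrences_constant_run[of l N r 2 1] twos l bal N
    by simp
  then have "l + N \<in> hitting_departures r"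
    using l shift[of l] rN by (simp add: hitting_departures_def)
  moreover have "j \<notin> hitting_departures r" if j: "l + N < j" "j \<le> 2 * N" for j
  proof -
    define k where "k = j - N"
    have k: "j = k + N" "l < k" "k \<le> N" using j by (auto simp: k_def)
    \<comment> \<open>Two periods contain \<open>N\<close> 2s, of which \<open>N - k\<close> come
      after \<open>j\<close>. So \<open>j\<close> is the \<open>k\<close>-th 2 and is compared with
      \<open>r k\<close>, again a 2.\<close>
    have "occurrences r 2 N = occurrences r 2 k + (N - k)"
      using occurrences_constant_run[of k N r 2 2] twos k by simp
    then have "occurrences r 2 (k + N) = k"
      using occurrences_add_period[OF per, of 2 k] bal N k by simp
    then show ?thesis
      using k twos[of k] shift[of k] by (simp add: hitting_departures_def)
  qed
  ultimately show ?thesis using l shift[of l]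
    by (intro bexI[of _ "l + N"]) auto
qed

end

section \<open>The two ends of a period of \<open>UD r\<close>\<close>

theorem theorem5p7:
  fixes r :: "nat \<Rightarrow> nat"
  assumes "two_state_rotor_type r"
    and "balanced r"
    and "palindromic (UD r)"
  shows "r 1 = r (period r)"
proof (rule ccontr)
  assume neq: "r 1 \<noteq> r (period r)"
  define N where "N = period r"
  define B where "B = hitting_departures r"
  have states: "r k \<in> {1, 2}" if "k \<ge> 1" for k
    using assms(1) that by (simp add: two_state_rotor_type_def)
  have r1: "r 1 = 1" using assms(1) by (simp add: two_state_rotor_type_def)
  have per: "is_period r N"
    using assms(1) is_period_period by (auto simp: two_state_rotor_type_def N_def)
  then have N1: "N \<ge> 1" by (simp add: is_period_def)
  have bal: "occurrences r 1 N = occurrences r 2 N"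
    using assms(2) by (simp add: balanced_def occurrences_def N_def)
  have rN: "r N = 2" using states[OF N1] neq r1 by (auto simp: N_def)
  have perB: "n + 2 * N \<in> B \<longleftrightarrow> n \<in> B" for n
    unfolding B_def by (rule hitting_departures_add_period[OF states per bal])
  obtain f where f: "f \<in> B" "r f = 2" "\<And>j. j < f \<Longrightarrow> j \<notin> B"
    using first_hitting_departure[OF states r1 N1 rN] unfolding B_def by blast
  obtain l where l: "l \<in> B" "l < 2 * N" "r l = 1" "\<And>j. l < j \<Longrightarrow> j \<le> 2 * N \<Longrightarrow> j \<notin> B"
    using last_hitting_departure[OF states per bal r1 rN] unfolding B_def by auto
  have inf: "infinite B"
  proof -
    have "f + j * (2 * N) \<in> B" for j
    proof (induction j)
      case (Suc j)
      then show ?case using perB[of "f + j * (2 * N)"] by (simp add: algebra_simps)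
    qed (use f in simp)
    moreover have "j \<le> f + j * (2 * N)" for j
      using N1 by (simp add: trans_le_add2)
    ultimately show ?thesis by (meson infinite_nat_iff_unbounded_le)
  qed
  have UD: "UD r k = r (enumerate B (k - 1))" for k
    using UD_eq[OF states] inf by (simp add: B_def)
  \<comment> \<open>The number of hits per \<open>2 * N\<close> departures is a period of
    \<open>UD r\<close>, possibly not the fundamental one.\<close>
  define H where "H = card {y \<in> B. y < 2 * N}"
  \<comment> \<open>Hence \<open>l\<close> has rank \<open>H - 1\<close>, counted from 0, and yields
    the \<open>H\<close>-th term of \<open>UD r\<close>.\<close>
  have "{y \<in> B. y < 2 * N} = insert l {y \<in> B. y < l}"
    using l by (auto simp: not_le[symmetric] not_less_iff_gr_or_eq)
  then have H: "H = Suc (card {y \<in> B. y < l})" by (simp add: H_def)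
  have "UD r (k + H) = UD r k" if k: "k \<ge> 1" for k
  proof -
    let ?x = "enumerate B (k - 1)"
    have "?x \<ge> 1"
      using inf enumerate_in_set[of B "k - 1"] by (simp add: B_def hitting_departures_def)
    moreover have "enumerate B (k + H - 1) = ?x + 2 * N"
      using enumerate_add_period[OF inf perB, of "k - 1"] k by (simp add: H_def)
    ultimately show ?thesis using UD is_period_mult[OF per] by simp
  qed
  then have perUD: "is_period (UD r) H" using H by (simp add: is_period_def)
  have "UD r H = 1"
    using UD[of H] H enumerate_card_less[OF inf l(1)] l(3) by simp
  then have last: "UD r (period (UD r)) = 1"
    using rotor_type_at_period[OF perUD] by simp
  have "{y \<in> B. y < f} = {}" using f(3) by blast
  then have "enumerate B 0 = f" using enumerate_card_less[OF inf f(1)] by (metis card.empty)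
  then have "UD r 1 = 2" using UD[of 1] f(2) by simp
  moreover have "period (UD r) \<ge> 1"
    using is_period_period[of "UD r"] perUD by (auto simp: rotor_type_def is_period_def)
  then have "UD r 1 = UD r (period (UD r))"
    using assms(3) unfolding palindromic_def by (metis add_diff_cancel_right' atLeastAtMost_iff order_refl)
  ultimately show False using last by simp
qed

end
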